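(* Let $\overline{\gamma}>0$ and $q\in[0,1]$, and let the instantaneous signal-to-noise ratio $\gamma$ follow the squared Hoyt distribution with average $\overline{\gamma}$ and parameter $q$, with pdf $f_\gamma$. Let $$\overline{C}^{\text{Hoyt}}=\int_0^\infty\log_2(1+\gamma)f_\gamma(\gamma)\,d\gamma$$ be the capacity per bandwidth unit using the optimum rate adaptation policy with constant transmit power. Then $$\overline{C}^{\text{Hoyt}}=\frac{\log_2(e)}{\pi}\int_0^\pi e^{1/\gamma(\theta,q)}E_1\left(\frac{1}{\gamma(\theta,q)}\right)d\theta,\qquad \gamma(\theta,q)=\overline{\gamma}\left(1-\frac{1-q^2}{1+q^2}\cos\theta\right),$$ and a lower bound is $$\overline{C}^{\text{Hoyt}}\ge\frac{1}{\ln 2}\,e^{(1+q^2)/(2q^2\overline{\gamma})}\,E_1\left(\frac{1+q^2}{2q^2\overline{\gamma}}\right).$$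
   Context: $E_1(x)=\int_x^\infty \frac{e^{-t}}{t}\,dt$ is the exponential integral function. The squared Hoyt distribution is the distribution of $X^2+Y^2$, where $X,Y$ are independent zero-mean Gaussian random variables with variances $\sigma_x^2$ and $\sigma_y^2$, $\sigma_y\le\sigma_x$. Its parameters are the average $\overline{\gamma}=\mathbb{E}\{X^2+Y^2\}$ and $q=\sigma_y/\sigma_x\in[0,1]$. Its pdf on $[0,\infty)$ is $$\frac{1+q^2}{2q\overline{\gamma}}\exp\left[-\frac{(1+q^2)^2x}{4q^2\overline{\gamma}}\right]I_0\left(\frac{(1-q^4)x}{4q^2\overline{\gamma}}\right),$$ with $I_0$ the modified Bessel function of the first kind and order zero, or alternatively $\frac{1}{\pi}\int_0^\pi\frac{1}{\gamma(\theta,q)}e^{-x/\gamma(\theta,q)}\,d\theta$. *)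

theory Defs
  imports "HOL-Probability.Probability"
begin

definition E1 :: "real \<Rightarrow> real" where
  "E1 x = (LBINT t:{x..}. exp (- t) / t)"

text \<open>The zero-mean Gaussian law with variance \<open>\<sigma>\<^sup>2\<close>. The case \<open>\<sigma> = 0\<close>, needed
  for \<open>q = 0\<close>, is the point mass at 0; \<^const>\<open>normal_density\<close> is not a density there.\<close>

definition gaussian_law :: "real \<Rightarrow> real measure" where
  "gaussian_law \<sigma> =
     (if \<sigma> = 0 then return borel 0 else density lborel (\<lambda>x. ennreal (normal_density 0 \<sigma> x)))"

definition gaussian_square_sum_law :: "real \<Rightarrow> real \<Rightarrow> real measure" where
  "gaussian_square_sum_law \<sigma>x \<sigma>y =
     distr (gaussian_law \<sigma>x \<Otimes>\<^sub>M gaussian_law \<sigma>y) borel (\<lambda>(x, y). x\<^sup>2 + y\<^sup>2)"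

lemma (in prob_space) distr_indep_gaussian_square_sum:
  assumes indep: "indep_var borel X borel Y"
    and X: "distr M borel X = gaussian_law \<sigma>x"
    and Y: "distr M borel Y = gaussian_law \<sigma>y"
  shows "distr M borel (\<lambda>\<omega>. (X \<omega>)\<^sup>2 + (Y \<omega>)\<^sup>2) = gaussian_square_sum_law \<sigma>x \<sigma>y"
proof -
  have rv [measurable]: "X \<in> borel_measurable M" "Y \<in> borel_measurable M"
    and eq: "distr M borel X \<Otimes>\<^sub>M distr M borel Y = distr M (borel \<Otimes>\<^sub>M borel) (\<lambda>\<omega>. (X \<omega>, Y \<omega>))"
    using indep by (auto simp: indep_var_distribution_eq)
  show ?thesis
    unfolding gaussian_square_sum_law_def X [symmetric] Y [symmetric] eq
    by (subst distr_distr) (auto simp: comp_def)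
qed

definition squared_hoyt :: "'a measure \<Rightarrow> ('a \<Rightarrow> real) \<Rightarrow> real \<Rightarrow> real \<Rightarrow> bool" where
  "squared_hoyt M \<Gamma> \<gamma>bar q \<longleftrightarrow>
     \<Gamma> \<in> borel_measurable M \<and>
     (\<exists>\<sigma>x \<sigma>y. 0 < \<sigma>x \<and> 0 \<le> \<sigma>y \<and> \<sigma>y \<le> \<sigma>x \<and>
        q = \<sigma>y / \<sigma>x \<and>
        \<gamma>bar = (\<integral>z. z \<partial>gaussian_square_sum_law \<sigma>x \<sigma>y) \<and>
        distr M borel \<Gamma> = gaussian_square_sum_law \<sigma>x \<sigma>y)"

text \<open>Only the values of \<open>f\<close> on \<open>[0, \<infinity>)\<close> matter.\<close>

definition has_pdf_on_nonneg :: "'a measure \<Rightarrow> ('a \<Rightarrow> real) \<Rightarrow> (real \<Rightarrow> real) \<Rightarrow> bool" where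
  "has_pdf_on_nonneg M \<Gamma> f \<longleftrightarrow>
     (\<forall>x\<ge>0. 0 \<le> f x) \<and> distributed M lborel \<Gamma> (\<lambda>x. ennreal (indicator {0..} x * f x))"

definition capacity :: "(real \<Rightarrow> real) \<Rightarrow> real" where
  "capacity f = (LBINT x:{0..}. log 2 (1 + x) * f x)"

definition hoyt_gamma :: "real \<Rightarrow> real \<Rightarrow> real \<Rightarrow> real" where
  "hoyt_gamma \<gamma>bar q \<theta> = \<gamma>bar * (1 - (1 - q\<^sup>2) / (1 + q\<^sup>2) * cos \<theta>)"

text \<open>The argument of the exponential is infinite at \<open>q = 0\<close>; the value of this function
  there (by HOL's division by zero) is meaningless, and the bound at \<open>q = 0\<close> has to be read
  as the limit for \<open>q\<close> tending to 0 from the right.\<close>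

definition hoyt_lower_bound :: "real \<Rightarrow> real \<Rightarrow> real" where
  "hoyt_lower_bound \<gamma>bar q =
     1 / ln 2 * exp ((1 + q\<^sup>2) / (2 * q\<^sup>2 * \<gamma>bar)) * E1 ((1 + q\<^sup>2) / (2 * q\<^sup>2 * \<gamma>bar))"

end

(* Both sides are mixtures of one Frullani integral. Write
     ln (1 + s) = integral over t > 0 of (1 - e^(-t s)) e^(-t) / t
   and, for g > 0,
     e^(1/g) E1(1/g) = integral over t > 0 of (1 - 1 / (1 + t g)) e^(-t) / t.
   By Tonelli the claim reduces to the Laplace transform of X^2 + Y^2, which is
   1 / sqrt ((1 + 2 t sx^2) (1 + 2 t sy^2)), being the mean of 1 / (1 + t gamma(theta)) over
   [0, pi]; this is the integral of 1 / (a - b cos theta) over a half period.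
   The lower bound holds because g |-> e^(1/g) E1(1/g) is increasing and gamma(theta) is
   minimal at theta = 0. *)
theory Submission imports Defs begin

section \<open>Frullani representation of the logarithm\<close>

text \<open>The quotient \<open>(1 - exp (- (t * s))) * exp (- t) / t\<close> is the integral of
  \<open>exp (- ((1 + u) * t))\<close> over \<open>u\<close> in \<open>[0, s]\<close>. By Tonelli
  the \<open>t\<close>-integral may be taken first; it gives \<open>1 / (1 + u)\<close>, whose
  integral over \<open>u\<close> is the logarithm.\<close>

lemma nn_integral_frullani_exp:
  fixes s :: real
  assumes "0 \<le> s"
  shows "(\<integral>\<^sup>+t. ennreal ((1 - exp (- (t * s))) * exp (- t) / t) * indicator {0..} t \<partial>lborel) = ennreal (ln (1 + s))"
proof -
  let ?F = "\<lambda>t u. ennreal (exp (- ((1 + u) * t))) * indicator {0..s} u * indicator {0..} t"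
  have inner_u: "(\<integral>\<^sup>+u. ?F t u \<partial>lborel) = ennreal ((1 - exp (- (t * s))) * exp (- t) / t) * indicator {0..} t"
    if "t \<noteq> 0" for t
  proof -
    have "(\<integral>\<^sup>+u. ennreal (exp (- ((1 + u) * t))) * indicator {0..s} u \<partial>lborel)
        = ennreal (- exp (- ((1 + s) * t)) / t - - exp (- ((1 + 0) * t)) / t)"
      using assms that
      by (intro nn_integral_FTC_Icc) (auto intro!: derivative_eq_intros simp: field_simps)
    also have "- exp (- ((1 + s) * t)) / t - - exp (- ((1 + 0) * t)) / t = (1 - exp (- (t * s))) * exp (- t) / t"
      by (simp add: algebra_simps exp_diff exp_minus exp_add divide_simps)
    finally show ?thesis
      by (subst nn_integral_multc) auto
  qed
  have inner_t: "(\<integral>\<^sup>+t. ?F t u \<partial>lborel) = ennreal (1 / (1 + u)) * indicator {0..s} u" for u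
  proof (cases "u \<in> {0..s}")
    case True
    then have u: "0 < 1 + u" by auto
    have "(\<integral>\<^sup>+t. ennreal (exp (- ((1 + u) * t))) * indicator {0..} t \<partial>lborel)
        = ennreal (0 - - exp (- ((1 + u) * 0)) / (1 + u))"
    proof (intro nn_integral_FTC_atLeast)
      have "filterlim (\<lambda>t. (1 + u) * t) at_top at_top"
        using u by (intro filterlim_tendsto_pos_mult_at_top[OF tendsto_const]) (auto intro: filterlim_ident)
      then have "((\<lambda>t. exp (- ((1 + u) * t))) \<longlongrightarrow> 0) at_top"
        by (intro filterlim_compose[OF exp_at_bot]) (simp add: filterlim_uminus_at_top)
      then have "((\<lambda>t. - exp (- ((1 + u) * t)) / (1 + u)) \<longlongrightarrow> - 0 / (1 + u)) at_top"
        using u by (intro tendsto_intros) auto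
      then show "((\<lambda>t. - exp (- ((1 + u) * t)) / (1 + u)) \<longlongrightarrow> 0) at_top" by simp
    next
      have "- (E * (- 1 - u) / (1 + u)) = E" for E
        using u by (simp add: field_simps)
      then show "DERIV (\<lambda>t. - exp (- ((1 + u) * t)) / (1 + u)) t :> exp (- ((1 + u) * t))" for t
        using u by (auto intro!: derivative_eq_intros)
    qed auto
    then show ?thesis using True by simp
  qed simp
  have "(\<integral>\<^sup>+t. ennreal ((1 - exp (- (t * s))) * exp (- t) / t) * indicator {0..} t \<partial>lborel)
      = (\<integral>\<^sup>+t. (\<integral>\<^sup>+u. ?F t u \<partial>lborel) \<partial>lborel)"
    \<comment> \<open>The point \<open>t = 0\<close> must be left out: there division by zero makes
      the left integrand 0, while the inner integral is \<open>s\<close>.\<close>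
    using AE_lborel_singleton[of 0]
    by (intro nn_integral_cong_AE) (auto elim!: eventually_mono simp: inner_u)
  also have "\<dots> = (\<integral>\<^sup>+u. (\<integral>\<^sup>+t. ?F t u \<partial>lborel) \<partial>lborel)"
    by (intro lborel_pair.Fubini') measurable
  also have "\<dots> = (\<integral>\<^sup>+u. ennreal (1 / (1 + u)) * indicator {0..s} u \<partial>lborel)"
    by (simp add: inner_t)
  also have "\<dots> = ennreal (ln (1 + s) - ln (1 + 0))"
    using assms by (intro nn_integral_FTC_Icc) (auto intro!: derivative_eq_intros simp: field_simps)
  finally show ?thesis by simp
qed

section \<open>Second moment and Laplace transform of the square of one Gaussian\<close>

lemma sets_gaussian_law [measurable_cong, simp]: "sets (gaussian_law \<sigma>) = sets borel"
  by (simp add: gaussian_law_def)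

lemma prob_space_gaussian_law:
  assumes "0 \<le> \<sigma>" shows "prob_space (gaussian_law \<sigma>)"
  using assms prob_space_normal_density[of \<sigma> 0]
  by (auto simp: gaussian_law_def intro!: prob_space_return)

lemma nn_integral_gaussian_law:
  assumes "0 < \<sigma>" and [measurable]: "g \<in> borel_measurable borel"
  shows "(\<integral>\<^sup>+x. g x \<partial>gaussian_law \<sigma>) = (\<integral>\<^sup>+x. ennreal (normal_density 0 \<sigma> x) * g x \<partial>lborel)"
  using assms by (simp add: gaussian_law_def nn_integral_density)

lemma gaussian_law_second_moment:
  assumes "0 \<le> \<sigma>"
  shows "(\<integral>\<^sup>+x. ennreal (x\<^sup>2) \<partial>gaussian_law \<sigma>) = ennreal (\<sigma>\<^sup>2)"
proof (cases "\<sigma> = 0")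
  case True
  then show ?thesis by (simp add: gaussian_law_def nn_integral_return)
next
  case False
  then have \<sigma>: "0 < \<sigma>" using assms by simp
  have "has_bochner_integral lborel (\<lambda>x. normal_density 0 \<sigma> x * x\<^sup>2) (\<sigma>\<^sup>2)"
    using normal_moment_even[OF \<sigma>, of 0 1] by (simp add: fact_numeral)
  then have "(\<integral>\<^sup>+x. ennreal (normal_density 0 \<sigma> x * x\<^sup>2) \<partial>lborel) = ennreal (\<sigma>\<^sup>2)"
    by (auto simp: has_bochner_integral_iff nn_integral_eq_integral)
  then show ?thesis using \<sigma> by (simp add: nn_integral_gaussian_law ennreal_mult)
qed

text \<open>Exponential tilting: the factor \<open>exp (- (t * x\<^sup>2))\<close> turns the density
  with deviation \<sigma> into \<open>1 / d\<close> times the density with deviation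
  \<open>\<sigma> / d\<close>, where \<open>d\<^sup>2 = 1 + 2 * t * \<sigma>\<^sup>2\<close>. The
  latter density has mass 1. For the point mass at 0 both sides are 1.\<close>

lemma gaussian_law_square_laplace:
  assumes "0 \<le> \<sigma>" "0 \<le> t"
  shows "(\<integral>\<^sup>+x. ennreal (exp (- (t * x\<^sup>2))) \<partial>gaussian_law \<sigma>) = ennreal (1 / sqrt (1 + 2 * t * \<sigma>\<^sup>2))"
proof (cases "\<sigma> = 0")
  case True
  then show ?thesis by (simp add: gaussian_law_def nn_integral_return)
next
  case False
  then have \<sigma>: "0 < \<sigma>" using assms by simp
  define d where "d = sqrt (1 + 2 * t * \<sigma>\<^sup>2)"
  have d: "0 < d" "d\<^sup>2 = 1 + 2 * t * \<sigma>\<^sup>2"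
    using assms by (auto simp: d_def add_pos_nonneg)
  have eq: "normal_density 0 \<sigma> x * exp (- (t * x\<^sup>2)) = (1 / d) * normal_density 0 (\<sigma> / d) x" for x
  proof -
    have "sqrt (2 * pi * (\<sigma> / d)\<^sup>2) = sqrt (2 * pi * \<sigma>\<^sup>2) / d"
      using d(1) by (simp add: power_divide real_sqrt_divide)
    moreover have "- x\<^sup>2 / (2 * (\<sigma> / d)\<^sup>2) = - x\<^sup>2 / (2 * \<sigma>\<^sup>2) + - (t * x\<^sup>2)"
      using \<sigma> d(1) by (simp add: power_divide d(2) field_simps)
    ultimately show ?thesis
      using d(1) unfolding normal_density_def by (simp add: exp_add mult_exp_exp)
  qed
  have "(\<integral>\<^sup>+x. ennreal (exp (- (t * x\<^sup>2))) \<partial>gaussian_law \<sigma>)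
      = (\<integral>\<^sup>+x. ennreal (1 / d) * ennreal (normal_density 0 (\<sigma> / d) x) \<partial>lborel)"
    using \<sigma> d(1) by (subst nn_integral_gaussian_law) (auto simp: ennreal_mult[symmetric] eq simp del: times_divide_eq_left)
  also have "\<dots> = ennreal (1 / d)"
    using \<sigma> d(1) by (simp add: nn_integral_cmult nn_integral_eq_integral)
  finally show ?thesis by (simp add: d_def)
qed

section \<open>The law of the sum of two independent Gaussian squares\<close>

lemma sets_gaussian_square_sum_law [measurable_cong, simp]:
  "sets (gaussian_square_sum_law \<sigma>x \<sigma>y) = sets borel"
  by (simp add: gaussian_square_sum_law_def)

lemma prob_space_gaussian_square_sum_law:
  assumes "0 \<le> \<sigma>x" "0 \<le> \<sigma>y"
  shows "prob_space (gaussian_square_sum_law \<sigma>x \<sigma>y)"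
proof -
  interpret X: prob_space "gaussian_law \<sigma>x" using assms by (simp add: prob_space_gaussian_law)
  interpret Y: prob_space "gaussian_law \<sigma>y" using assms by (simp add: prob_space_gaussian_law)
  interpret XY: pair_prob_space "gaussian_law \<sigma>x" "gaussian_law \<sigma>y" ..
  show ?thesis unfolding gaussian_square_sum_law_def by (rule XY.prob_space_distr) measurable
qed

lemma nn_integral_gaussian_square_sum_law:
  assumes "0 \<le> \<sigma>y" and [measurable]: "g \<in> borel_measurable borel"
  shows "(\<integral>\<^sup>+z. g z \<partial>gaussian_square_sum_law \<sigma>x \<sigma>y)
      = (\<integral>\<^sup>+x. \<integral>\<^sup>+y. g (x\<^sup>2 + y\<^sup>2) \<partial>gaussian_law \<sigma>y \<partial>gaussian_law \<sigma>x)"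
proof -
  interpret Y: prob_space "gaussian_law \<sigma>y" using assms by (simp add: prob_space_gaussian_law)
  have "(\<integral>\<^sup>+z. g z \<partial>gaussian_square_sum_law \<sigma>x \<sigma>y)
      = (\<integral>\<^sup>+p. g ((\<lambda>(x, y). x\<^sup>2 + y\<^sup>2) p) \<partial>(gaussian_law \<sigma>x \<Otimes>\<^sub>M gaussian_law \<sigma>y))"
    unfolding gaussian_square_sum_law_def by (rule nn_integral_distr) measurable
  then show ?thesis by (subst (asm) Y.nn_integral_fst[symmetric]) simp_all
qed

lemma AE_gaussian_square_sum_law_nonneg:
  "AE z in gaussian_square_sum_law \<sigma>x \<sigma>y. 0 \<le> z"
  unfolding gaussian_square_sum_law_def by (subst AE_distr_iff) auto

text \<open>Expresses the average, which \<open>squared_hoyt\<close> gives only as an integral,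
  through the two variances. The law lives on the nonnegative reals, so the integral can be computed
  in \<open>ennreal\<close>.\<close>

lemma gaussian_square_sum_law_mean:
  assumes "0 \<le> \<sigma>x" "0 \<le> \<sigma>y"
  shows "(\<integral>z. z \<partial>gaussian_square_sum_law \<sigma>x \<sigma>y) = \<sigma>x\<^sup>2 + \<sigma>y\<^sup>2"
proof -
  interpret X: prob_space "gaussian_law \<sigma>x" using assms by (simp add: prob_space_gaussian_law)
  interpret Y: prob_space "gaussian_law \<sigma>y" using assms by (simp add: prob_space_gaussian_law)
  have "(\<integral>\<^sup>+z. ennreal z \<partial>gaussian_square_sum_law \<sigma>x \<sigma>y) = ennreal (\<sigma>x\<^sup>2 + \<sigma>y\<^sup>2)"
    using assms
    by (simp add: nn_integral_gaussian_square_sum_law nn_integral_add gaussian_law_second_moment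
        ennreal_plus X.emeasure_space_1 Y.emeasure_space_1)
  then show ?thesis
    by (subst integral_eq_nn_integral)
       (auto simp: AE_gaussian_square_sum_law_nonneg simp del: ennreal_plus)
qed

text \<open>The exponential of a sum factors over the product measure, so the two one-dimensional
  transforms multiply.\<close>

lemma gaussian_square_sum_law_laplace:
  assumes "0 \<le> \<sigma>x" "0 \<le> \<sigma>y" "0 \<le> t"
  shows "(\<integral>\<^sup>+z. ennreal (exp (- (t * z))) \<partial>gaussian_square_sum_law \<sigma>x \<sigma>y)
      = ennreal (1 / sqrt ((1 + 2 * t * \<sigma>x\<^sup>2) * (1 + 2 * t * \<sigma>y\<^sup>2)))"
proof -
  have "exp (- (t * (x\<^sup>2 + y\<^sup>2))) = exp (- (t * x\<^sup>2)) * exp (- (t * y\<^sup>2))" for x y :: real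
    by (simp add: mult_exp_exp algebra_simps)
  then have "(\<integral>\<^sup>+z. ennreal (exp (- (t * z))) \<partial>gaussian_square_sum_law \<sigma>x \<sigma>y)
      = ennreal (1 / sqrt (1 + 2 * t * \<sigma>x\<^sup>2)) * ennreal (1 / sqrt (1 + 2 * t * \<sigma>y\<^sup>2))"
    using assms
    by (simp add: nn_integral_gaussian_square_sum_law ennreal_mult nn_integral_cmult nn_integral_multc
        gaussian_law_square_laplace)
  then show ?thesis
    using assms by (simp add: ennreal_mult[symmetric] real_sqrt_mult)
qed

section \<open>The cosine integral over a half period\<close>

text \<open>Fundamental theorem of calculus with the explicit antiderivative \<open>?F\<close>. The
  sine vanishes at both ends, so the arctangent drops out and only \<open>pi / w\<close>
  remains.\<close>

lemma nn_integral_inverse_affine_cos: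
  fixes a b :: real
  assumes "0 \<le> b" "b < a"
  shows "(\<integral>\<^sup>+\<theta>. ennreal (1 / (a - b * cos \<theta>)) * indicator {0..pi} \<theta> \<partial>lborel) = ennreal (pi / sqrt (a\<^sup>2 - b\<^sup>2))"
proof -
  define w where "w = sqrt (a\<^sup>2 - b\<^sup>2)"
  have "b\<^sup>2 < a\<^sup>2" using assms by (simp add: power_strict_mono)
  then have w: "0 < w" "w\<^sup>2 = a\<^sup>2 - b\<^sup>2" by (auto simp: w_def)
  \<comment> \<open>Unlike the half-angle form with \<open>tan (\<theta> / 2)\<close>, this antiderivative is smooth up to \<open>\<theta> = pi\<close>.\<close>
  let ?F = "\<lambda>\<theta>. (\<theta> + 2 * arctan (b * sin \<theta> / (a + w - b * cos \<theta>))) / w"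
  have bc: "b * cos \<theta> \<le> b" for \<theta> using assms mult_left_mono[OF cos_le_one, of b] by simp
  have "(\<integral>\<^sup>+\<theta>. ennreal (1 / (a - b * cos \<theta>)) * indicator {0..pi} \<theta> \<partial>lborel) = ennreal (?F pi - ?F 0)"
  proof (intro nn_integral_FTC_Icc)
    fix \<theta> :: real
    have pos: "0 < a - b * cos \<theta>" using bc[of \<theta>] assms by linarith
    \<comment> \<open>\<open>D\<close> is the denominator inside the arctangent. The facts
      \<open>sq\<close> and \<open>num\<close> simplify the denominator and the numerator of the
      derivative of the arctangent term.\<close>
    define D where "D = a + w - b * cos \<theta>"
    have D: "0 < D" using pos w by (simp add: D_def)
    have s2: "(sin \<theta>)\<^sup>2 = 1 - (cos \<theta>)\<^sup>2" using sin_cos_squared_add[of \<theta>] by linarith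
    \<comment> \<open>As \<open>b\<^sup>2 = (a - w) * (a + w)\<close>, the factor
      \<open>a + w\<close> splits off; it cancels at the end.\<close>
    have sq: "D\<^sup>2 + (b * sin \<theta>)\<^sup>2 = 2 * (a + w) * (a - b * cos \<theta>)"
      using w(2) unfolding D_def power_mult_distrib s2 by (simp add: power2_eq_square algebra_simps)
    have num: "b * cos \<theta> * D - b * sin \<theta> * (b * sin \<theta>) = (a + w) * (b * cos \<theta>) - b\<^sup>2"
    proof -
      have "b * sin \<theta> * (b * sin \<theta>) = b\<^sup>2 * (1 - (cos \<theta>)\<^sup>2)"
        unfolding s2[symmetric] by (simp add: power2_eq_square)
      then show ?thesis unfolding D_def by (simp add: power2_eq_square algebra_simps)
    qed
    have der: "DERIV ?F \<theta> :> (1 + 2 * ((b * cos \<theta> * D - b * sin \<theta> * (b * sin \<theta>)) / (D * D)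
        / (1 + (b * sin \<theta> / D)\<^sup>2))) / w"
    proof -
      have "DERIV (\<lambda>\<theta>. b * sin \<theta> / (a + w - b * cos \<theta>)) \<theta> :>
          (b * cos \<theta> * D - b * sin \<theta> * (b * sin \<theta>)) / (D * D)"
        using D unfolding D_def by (auto intro!: derivative_eq_intros)
      note DERIV_chain2[OF DERIV_arctan this]
      from DERIV_cdivide[OF DERIV_add[OF DERIV_ident DERIV_cmult[OF this, of 2]], of w]
      show ?thesis
        unfolding D_def by (simp only: divide_inverse mult_ac)
    qed
    have "(b * cos \<theta> * D - b * sin \<theta> * (b * sin \<theta>)) / (D * D) / (1 + (b * sin \<theta> / D)\<^sup>2)
        = (b * cos \<theta> * D - b * sin \<theta> * (b * sin \<theta>)) / (D\<^sup>2 + (b * sin \<theta>)\<^sup>2)"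
    proof -
      have "1 + (b * sin \<theta> / D)\<^sup>2 = (D\<^sup>2 + (b * sin \<theta>)\<^sup>2) / (D * D)"
        using D by (simp add: power_divide power2_eq_square field_simps)
      then show ?thesis using D by simp
    qed
    also have "\<dots> = ((a + w) * (b * cos \<theta>) - b\<^sup>2) / (2 * (a + w) * (a - b * cos \<theta>))"
      by (simp only: num sq)
    finally have e: "(b * cos \<theta> * D - b * sin \<theta> * (b * sin \<theta>)) / (D * D) / (1 + (b * sin \<theta> / D)\<^sup>2)
        = ((a + w) * (b * cos \<theta>) - b\<^sup>2) / (2 * (a + w) * (a - b * cos \<theta>))" .
    have "(1 + 2 * (((a + w) * (b * cos \<theta>) - b\<^sup>2) / (2 * (a + w) * (a - b * cos \<theta>)))) / w
        = ((a + w) * a - b\<^sup>2) / ((a + w) * (a - b * cos \<theta>) * w)"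
    proof -
      have *: "(1 + 2 * (N / (2 * A * P))) / w = (A * P + N) / (A * P * w)"
        if "0 < A" "0 < P" for N A P
        using that w(1) by (simp add: field_simps)
      have "0 < a + w" using assms w by linarith
      moreover have "(a + w) * (a - b * cos \<theta>) + ((a + w) * (b * cos \<theta>) - b\<^sup>2) = (a + w) * a - b\<^sup>2"
        by (simp add: algebra_simps)
      ultimately show ?thesis
        using *[of "a + w" "a - b * cos \<theta>" "(a + w) * (b * cos \<theta>) - b\<^sup>2"] pos by presburger
    qed
    also have "(a + w) * a - b\<^sup>2 = (a + w) * w"
      using w(2) by (simp add: power2_eq_square algebra_simps)
    also have "(a + w) * w / ((a + w) * (a - b * cos \<theta>) * w) = 1 / (a - b * cos \<theta>)"
      using w(1) assms by simp
    finally show "DERIV ?F \<theta> :> 1 / (a - b * cos \<theta>)" using der by (simp only: e)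
    show "0 \<le> 1 / (a - b * cos \<theta>)" using pos by simp
  qed auto
  then show ?thesis by (simp add: w_def)
qed

section \<open>The exponential integral\<close>

text \<open>The shift of the integration variable by \<open>x\<close> moves the domain of
  \<open>E1\<close> to \<open>[0, \<infinity>)\<close> and yields the factor
  \<open>exp (- x)\<close>. The bound then follows from \<open>x + t \<ge> x\<close> and the total
  mass 1 of \<open>exp (- t)\<close>.\<close>

lemma
  assumes "0 < x"
  shows exp_mult_E1: "ennreal (exp x * E1 x) = (\<integral>\<^sup>+t. ennreal (exp (- t) / (x + t)) * indicator {0..} t \<partial>lborel)"
    and E1_nonneg: "0 \<le> E1 x"
    and exp_mult_E1_le: "exp x * E1 x \<le> 1 / x"
proof -
  let ?g = "\<lambda>t. indicator {x..} t *\<^sub>R (exp (- t) / t)"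
  let ?J = "\<integral>\<^sup>+t. ennreal (exp (- t) / (x + t)) * indicator {0..} t \<partial>lborel"
  have exp_int: "(\<integral>\<^sup>+t. ennreal (exp (- t)) * indicator {0..} t \<partial>lborel) = ennreal (0 - - exp (- 0))"
  proof (intro nn_integral_FTC_atLeast)
    have "((\<lambda>t. - exp (- t)) \<longlongrightarrow> - 0) (at_top :: real filter)"
      by (intro tendsto_intros filterlim_compose[OF exp_at_bot] filterlim_uminus_at_bot_at_top)
    then show "((\<lambda>t. - exp (- t)) \<longlongrightarrow> 0) (at_top :: real filter)" by simp
  qed (auto intro!: derivative_eq_intros)
  have "?J \<le> (\<integral>\<^sup>+t. ennreal (1 / x) * (ennreal (exp (- t)) * indicator {0..} t) \<partial>lborel)"
  proof (intro nn_integral_mono)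
    fix t :: real
    show "ennreal (exp (- t) / (x + t)) * indicator {0..} t
        \<le> ennreal (1 / x) * (ennreal (exp (- t)) * indicator {0..} t)"
      using assms by (auto simp: ennreal_mult[symmetric] divide_simps split: split_indicator intro!: ennreal_leI)
  qed
  also have "\<dots> = ennreal (1 / x)"
    by (simp add: nn_integral_cmult exp_int)
  finally have J_le: "?J \<le> ennreal (1 / x)" .
  have "(\<integral>\<^sup>+t. ennreal (?g t) \<partial>lborel) = (\<integral>\<^sup>+t. ennreal (?g (x + 1 * t)) \<partial>lborel)"
    by (subst nn_integral_real_affine[where c = 1 and t = x]) auto
  also have "\<dots> = (\<integral>\<^sup>+t. ennreal (exp (- x)) * (ennreal (exp (- t) / (x + t)) * indicator {0..} t) \<partial>lborel)"
    using assms
    by (intro nn_integral_cong)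
       (auto simp: ennreal_mult[symmetric] mult_exp_exp split: split_indicator)
  also have "\<dots> = ennreal (exp (- x)) * ?J"
    by (intro nn_integral_cmult) measurable
  finally have g: "(\<integral>\<^sup>+t. ennreal (?g t) \<partial>lborel) = ennreal (exp (- x)) * ?J" .
  have "E1 x = enn2real (\<integral>\<^sup>+t. ennreal (?g t) \<partial>lborel)"
    unfolding E1_def set_lebesgue_integral_def
    using assms by (intro integral_eq_nn_integral) (auto split: split_indicator)
  then have E1: "E1 x = exp (- x) * enn2real ?J" unfolding g by (simp add: enn2real_mult)
  then show "0 \<le> E1 x" by simp
  have ex: "exp x * E1 x = enn2real ?J" unfolding E1 by (simp add: exp_minus)
  show "ennreal (exp x * E1 x) = ?J"
    \<comment> \<open>The bound makes \<open>?J\<close> finite, so that \<open>enn2real\<close>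
      loses nothing.\<close>
    unfolding ex using J_le by (intro ennreal_enn2real) (rule le_less_trans, auto)
  show "exp x * E1 x \<le> 1 / x"
    unfolding ex using enn2real_mono[OF J_le] assms by simp
qed

lemma borel_measurable_E1 [measurable]: "E1 \<in> borel_measurable borel"
  \<comment> \<open>\<open>x\<close> also enters through the domain of integration; with the
    indicator unfolded to a comparison, the integrand is visibly measurable in \<open>x\<close> and
    \<open>t\<close> jointly.\<close>
  unfolding E1_def[abs_def] set_lebesgue_integral_def indicator_def atLeast_iff by measurable

text \<open>This is the Frullani form with \<open>1 / (1 + t * g)\<close>, the Laplace transform of
  the exponential law with mean \<open>g\<close>, in place of \<open>exp (- (t * s))\<close>. The
  integrands of this form and of \<open>exp_mult_E1\<close> agree for \<open>t > 0\<close>, but not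
  at \<open>t = 0\<close>.\<close>

lemma exp_mult_E1_inverse:
  fixes g :: real
  assumes "0 < g"
  shows "ennreal (exp (1 / g) * E1 (1 / g))
    = (\<integral>\<^sup>+t. ennreal ((1 - 1 / (1 + t * g)) * exp (- t) / t) * indicator {0..} t \<partial>lborel)"
proof -
  have "exp (- t) / (1 / g + t) = (1 - 1 / (1 + t * g)) * exp (- t) / t" if "0 < t" for t
  proof -
    have "0 < 1 + t * g" using that assms by (simp add: add_pos_pos)
    then have "1 - 1 / (1 + t * g) = t * g / (1 + t * g)" "1 / g + t = (1 + t * g) / g"
      using assms by (simp_all add: field_simps)
    then show ?thesis using that assms by simp
  qed
  then show ?thesis
    using assms AE_lborel_singleton[of 0]
    by (subst exp_mult_E1, simp, intro nn_integral_cong_AE)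
       (auto elim!: eventually_mono split: split_indicator)
qed

text \<open>In the shifted integral the integrand \<open>exp (- t) / (x + t)\<close> decreases in
  \<open>x = 1 / g\<close>.\<close>

lemma exp_mult_E1_inverse_mono:
  assumes "0 < g" "g \<le> g'"
  shows "exp (1 / g) * E1 (1 / g) \<le> exp (1 / g') * E1 (1 / g')"
proof -
  have "ennreal (exp (1 / g) * E1 (1 / g)) \<le> ennreal (exp (1 / g') * E1 (1 / g'))"
    using assms
    by (subst (1 2) exp_mult_E1)
       (auto intro!: nn_integral_mono ennreal_leI divide_left_mono add_mono mult_pos_pos add_pos_nonneg
          simp: frac_le split: split_indicator)
  then show ?thesis
    using assms by (subst (asm) ennreal_le_iff) (auto intro!: mult_nonneg_nonneg E1_nonneg)
qed

section \<open>Mixtures of Frullani integrals\<close>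

text \<open>Subtraction in \<open>ennreal\<close> is truncated; the bounds on \<open>f\<close> and
  the finite integral make it behave like real subtraction.\<close>

lemma (in prob_space) nn_integral_one_minus:
  fixes f :: "'a \<Rightarrow> real"
  assumes [measurable]: "f \<in> borel_measurable M"
    and bounds: "AE x in M. 0 \<le> f x \<and> f x \<le> 1"
    and "(\<integral>\<^sup>+x. ennreal (f x) \<partial>M) = ennreal d" "0 \<le> d"
  shows "(\<integral>\<^sup>+x. ennreal (1 - f x) \<partial>M) = ennreal (1 - d)"
proof -
  have "(\<integral>\<^sup>+x. ennreal (1 - f x) \<partial>M) = (\<integral>\<^sup>+x. 1 - ennreal (f x) \<partial>M)"
  proof (intro nn_integral_cong_AE)
    show "AE x in M. ennreal (1 - f x) = 1 - ennreal (f x)"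
      using bounds by eventually_elim (simp add: ennreal_minus flip: ennreal_1)
  qed
  also have "\<dots> = (\<integral>\<^sup>+x. 1 \<partial>M) - (\<integral>\<^sup>+x. ennreal (f x) \<partial>M)"
    using assms by (intro nn_integral_diff) (auto elim!: eventually_mono)
  also have "\<dots> = ennreal (1 - d)"
    using ennreal_minus[OF \<open>0 \<le> d\<close>, of 1] by (simp add: emeasure_space_1 assms(3))
  finally show ?thesis .
qed

text \<open>After Tonelli the kernel \<open>k\<close> enters only through its mean
  \<open>\<phi>\<close>. Hence two mixtures over different probability spaces agree as soon as their
  mean kernels do.\<close>

lemma (in prob_space) nn_integral_frullani_mixture:
  fixes k :: "real \<Rightarrow> 'a \<Rightarrow> real"
  assumes [measurable]: "case_prod k \<in> borel_measurable (borel \<Otimes>\<^sub>M M)"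
    and bounds: "\<And>t. 0 \<le> t \<Longrightarrow> AE x in M. 0 \<le> k t x \<and> k t x \<le> 1"
    and mean: "\<And>t. 0 \<le> t \<Longrightarrow> (\<integral>\<^sup>+x. ennreal (k t x) \<partial>M) = ennreal (\<phi> t)"
    and "\<And>t. 0 \<le> t \<Longrightarrow> 0 \<le> \<phi> t"
  shows "(\<integral>\<^sup>+x. \<integral>\<^sup>+t. ennreal ((1 - k t x) * exp (- t) / t) * indicator {0..} t \<partial>lborel \<partial>M)
    = (\<integral>\<^sup>+t. ennreal ((1 - \<phi> t) * exp (- t) / t) * indicator {0..} t \<partial>lborel)"
proof -
  interpret pair_sigma_finite lborel M ..
  have "(\<integral>\<^sup>+x. \<integral>\<^sup>+t. ennreal ((1 - k t x) * exp (- t) / t) * indicator {0..} t \<partial>lborel \<partial>M)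
      = (\<integral>\<^sup>+t. \<integral>\<^sup>+x. ennreal ((1 - k t x) * exp (- t) / t) * indicator {0..} t \<partial>M \<partial>lborel)"
    by (intro Fubini') measurable
  also have "\<dots> = (\<integral>\<^sup>+t. ennreal ((1 - \<phi> t) * exp (- t) / t) * indicator {0..} t \<partial>lborel)"
  proof (intro nn_integral_cong)
    fix t :: real
    show "(\<integral>\<^sup>+x. ennreal ((1 - k t x) * exp (- t) / t) * indicator {0..} t \<partial>M)
        = ennreal ((1 - \<phi> t) * exp (- t) / t) * indicator {0..} t"
    proof (cases "0 \<le> t")
      case True
      have [measurable]: "k t \<in> borel_measurable M"
        using measurable_Pair2[of "case_prod k" borel M borel t] by simp
      have "(\<integral>\<^sup>+x. ennreal ((1 - k t x) * exp (- t) / t) \<partial>M)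
          = (\<integral>\<^sup>+x. ennreal (1 - k t x) * ennreal (exp (- t) / t) \<partial>M)"
        using True by (simp add: ennreal_mult''[symmetric])
      also have "\<dots> = ennreal (1 - \<phi> t) * ennreal (exp (- t) / t)"
        using True assms by (simp add: nn_integral_multc nn_integral_one_minus)
      finally show ?thesis using True by (simp add: ennreal_mult''[symmetric])
    qed simp
  qed
  finally show ?thesis .
qed

text \<open>The mixture lemma is applied twice with the same \<open>?\<phi>\<close>: to
  \<open>exp (- (t * z))\<close> under the law of the sum of squares, and to
  \<open>1 / (1 + t * g \<theta>)\<close> under the uniform law on \<open>[0, pi]\<close>. Here
  \<open>g\<close> is \<open>hoyt_gamma\<close> written with the variances.\<close>

lemma nn_integral_log_gaussian_square_sum_law:
  assumes "0 < \<sigma>x" "0 \<le> \<sigma>y" "\<sigma>y \<le> \<sigma>x"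
  defines "g \<equiv> \<lambda>\<theta>. (\<sigma>x\<^sup>2 + \<sigma>y\<^sup>2) - (\<sigma>x\<^sup>2 - \<sigma>y\<^sup>2) * cos \<theta>"
  shows "(\<integral>\<^sup>+z. ennreal (ln (1 + z)) \<partial>gaussian_square_sum_law \<sigma>x \<sigma>y)
    = (\<integral>\<^sup>+\<theta>. ennreal (exp (1 / g \<theta>) * E1 (1 / g \<theta>)) * indicator {0..pi} \<theta> \<partial>lborel) / ennreal pi"
proof -
  let ?L = "gaussian_square_sum_law \<sigma>x \<sigma>y"
  let ?U = "uniform_measure lborel {0..pi}"
  let ?\<phi> = "\<lambda>t. 1 / sqrt ((1 + 2 * t * \<sigma>x\<^sup>2) * (1 + 2 * t * \<sigma>y\<^sup>2))"
  interpret L: prob_space ?L using assms by (intro prob_space_gaussian_square_sum_law) auto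
  interpret U: prob_space ?U by (rule prob_space_uniform_measure) auto
  have \<sigma>: "\<sigma>y\<^sup>2 \<le> \<sigma>x\<^sup>2" "0 < \<sigma>x\<^sup>2" using assms by (auto intro: power_mono)
  have [measurable]: "g \<in> borel_measurable borel" unfolding g_def by measurable
  have uniform: "(\<integral>\<^sup>+\<theta>. h \<theta> \<partial>?U) = (\<integral>\<^sup>+\<theta>. h \<theta> * indicator {0..pi} \<theta> \<partial>lborel) / ennreal pi"
    if [measurable]: "h \<in> borel_measurable borel" for h
    by (simp add: nn_integral_uniform_measure)
  have g_nonneg: "0 \<le> g \<theta>" for \<theta>
  proof -
    have "(\<sigma>x\<^sup>2 - \<sigma>y\<^sup>2) * cos \<theta> \<le> (\<sigma>x\<^sup>2 - \<sigma>y\<^sup>2) * 1"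
      using \<sigma> by (intro mult_left_mono) auto
    also have "\<dots> \<le> \<sigma>x\<^sup>2 + \<sigma>y\<^sup>2" by simp
    finally show ?thesis unfolding g_def by simp
  qed
  \<comment> \<open>The angle 0 is excluded because \<open>g 0 = 2 * \<sigma>y\<^sup>2\<close>
    vanishes in the degenerate case; being a null set, it does not affect the integral.\<close>
  have g_pos: "0 < g \<theta>" if "0 < \<theta>" "\<theta> \<le> pi" for \<theta>
  proof -
    have "cos \<theta> < 1" using cos_monotone_0_pi[of 0 \<theta>] that by simp
    show ?thesis
    proof (cases "\<sigma>x\<^sup>2 = \<sigma>y\<^sup>2")
      case True
      then show ?thesis using \<sigma> by (simp add: g_def)
    next
      case False
      then have "(\<sigma>x\<^sup>2 - \<sigma>y\<^sup>2) * cos \<theta> < (\<sigma>x\<^sup>2 - \<sigma>y\<^sup>2) * 1"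
        using \<sigma> \<open>cos \<theta> < 1\<close> by (intro mult_strict_left_mono) auto
      also have "\<dots> \<le> \<sigma>x\<^sup>2 + \<sigma>y\<^sup>2" by simp
      finally show ?thesis unfolding g_def by simp
    qed
  qed
  have "(\<integral>\<^sup>+z. ennreal (ln (1 + z)) \<partial>?L)
      = (\<integral>\<^sup>+z. \<integral>\<^sup>+t. ennreal ((1 - exp (- (t * z))) * exp (- t) / t) * indicator {0..} t \<partial>lborel \<partial>?L)"
    by (intro nn_integral_cong_AE eventually_mono[OF AE_gaussian_square_sum_law_nonneg])
       (simp add: nn_integral_frullani_exp)
  also have "\<dots> = (\<integral>\<^sup>+t. ennreal ((1 - ?\<phi> t) * exp (- t) / t) * indicator {0..} t \<partial>lborel)"
  proof (rule L.nn_integral_frullani_mixture)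
    show "AE z in ?L. 0 \<le> exp (- (t * z)) \<and> exp (- (t * z)) \<le> 1" if "0 \<le> t" for t
      using that by (intro eventually_mono[OF AE_gaussian_square_sum_law_nonneg]) simp
    show "(\<integral>\<^sup>+z. ennreal (exp (- (t * z))) \<partial>?L) = ennreal (?\<phi> t)" if "0 \<le> t" for t
      using assms that by (intro gaussian_square_sum_law_laplace) auto
  qed (auto, measurable)
  also have "\<dots> = (\<integral>\<^sup>+\<theta>. \<integral>\<^sup>+t. ennreal ((1 - 1 / (1 + t * g \<theta>)) * exp (- t) / t) * indicator {0..} t \<partial>lborel \<partial>?U)"
  proof (rule U.nn_integral_frullani_mixture[symmetric])
    show "AE \<theta> in ?U. 0 \<le> 1 / (1 + t * g \<theta>) \<and> 1 / (1 + t * g \<theta>) \<le> 1" if "0 \<le> t" for t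
    proof (intro AE_I2)
      fix \<theta>
      have "0 \<le> t * g \<theta>" using that g_nonneg by simp
      then show "0 \<le> 1 / (1 + t * g \<theta>) \<and> 1 / (1 + t * g \<theta>) \<le> 1" by simp
    qed
    show "(\<integral>\<^sup>+\<theta>. ennreal (1 / (1 + t * g \<theta>)) \<partial>?U) = ennreal (?\<phi> t)" if "0 \<le> t" for t
    proof -
      \<comment> \<open>Chosen so that \<open>1 + t * g \<theta> = ?a - ?b * cos \<theta>\<close>;
        then \<open>?a - ?b\<close> and \<open>?a + ?b\<close> are exactly the two factors under the
        root in \<open>?\<phi>\<close>.\<close>
      let ?a = "1 + t * (\<sigma>x\<^sup>2 + \<sigma>y\<^sup>2)" and ?b = "t * (\<sigma>x\<^sup>2 - \<sigma>y\<^sup>2)"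
      have "?b \<le> t * (\<sigma>x\<^sup>2 + \<sigma>y\<^sup>2)" using that by (intro mult_left_mono) auto
      then have ab: "0 \<le> ?b" "?b < ?a" using that \<sigma> by auto
      have g: "1 + t * g \<theta> = ?a - ?b * cos \<theta>" for \<theta>
        by (simp add: g_def algebra_simps)
      have sq: "?a\<^sup>2 - ?b\<^sup>2 = (1 + 2 * t * \<sigma>x\<^sup>2) * (1 + 2 * t * \<sigma>y\<^sup>2)"
        by (simp add: power2_eq_square algebra_simps)
      have "(\<integral>\<^sup>+\<theta>. ennreal (1 / (1 + t * g \<theta>)) \<partial>?U)
          = (\<integral>\<^sup>+\<theta>. ennreal (1 / (1 + t * g \<theta>)) * indicator {0..pi} \<theta> \<partial>lborel) / ennreal pi"
        by (rule uniform) measurable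
      also have "\<dots> = ennreal (pi / sqrt (?a\<^sup>2 - ?b\<^sup>2)) / ennreal pi"
        unfolding g by (simp only: nn_integral_inverse_affine_cos[OF ab])
      also have "\<dots> = ennreal (pi * ?\<phi> t) / ennreal pi"
        unfolding sq by simp
      also have "\<dots> = ennreal (?\<phi> t)"
        using that by (subst divide_ennreal) auto
      finally show ?thesis .
    qed
  qed (auto, measurable)
  also have "\<dots> = (\<integral>\<^sup>+\<theta>. ennreal (exp (1 / g \<theta>) * E1 (1 / g \<theta>)) \<partial>?U)"
  proof (intro nn_integral_cong_AE)
    have "AE \<theta> in ?U. 0 < g \<theta>"
      using AE_lborel_singleton[of "0::real"]
      by (intro AE_uniform_measureI) (auto elim!: eventually_mono intro!: g_pos)
    then show "AE \<theta> in ?U. (\<integral>\<^sup>+t. ennreal ((1 - 1 / (1 + t * g \<theta>)) * exp (- t) / t) * indicator {0..} t \<partial>lborel)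
        = ennreal (exp (1 / g \<theta>) * E1 (1 / g \<theta>))"
      by eventually_elim (simp only: exp_mult_E1_inverse)
  qed
  finally show ?thesis by (simp add: uniform)
qed

section \<open>The lower bound as \<open>q\<close> tends to 0\<close>

lemma hoyt_lower_bound_nonneg:
  assumes "0 < \<gamma>bar" "0 < q"
  shows "0 \<le> hoyt_lower_bound \<gamma>bar q"
  unfolding hoyt_lower_bound_def using assms
  by (intro mult_nonneg_nonneg E1_nonneg divide_pos_pos add_pos_pos mult_pos_pos) auto

text \<open>The estimate \<open>exp x * E1 x \<le> 1 / x\<close> squeezes the bound between 0 and a
  multiple of \<open>q\<^sup>2 / (1 + q\<^sup>2)\<close>.\<close>

lemma hoyt_lower_bound_tendsto_0:
  assumes "0 < \<gamma>bar"
  shows "(hoyt_lower_bound \<gamma>bar \<longlongrightarrow> 0) (at_right 0)"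
proof (rule tendsto_sandwich)
  let ?u = "\<lambda>q. 1 / ln 2 * (2 * q\<^sup>2 * \<gamma>bar / (1 + q\<^sup>2))"
  have q: "\<forall>\<^sub>F q :: real in at_right 0. 0 < q" by (simp add: eventually_at_right_less)
  show "\<forall>\<^sub>F q in at_right 0. 0 \<le> hoyt_lower_bound \<gamma>bar q"
    using q by eventually_elim (simp add: hoyt_lower_bound_nonneg assms)
  show "\<forall>\<^sub>F q in at_right 0. hoyt_lower_bound \<gamma>bar q \<le> ?u q"
    using q
  proof eventually_elim
    case (elim q)
    define x where "x = (1 + q\<^sup>2) / (2 * q\<^sup>2 * \<gamma>bar)"
    have x: "0 < x" using elim assms unfolding x_def by (intro divide_pos_pos add_pos_pos mult_pos_pos) auto
    have "1 / ln 2 * (exp x * E1 x) \<le> 1 / ln 2 * (1 / x)"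
      by (intro mult_left_mono exp_mult_E1_le x) auto
    then show ?case by (simp add: hoyt_lower_bound_def x_def mult.assoc)
  qed
  have "(?u \<longlongrightarrow> 1 / ln 2 * (2 * 0\<^sup>2 * \<gamma>bar / (1 + 0\<^sup>2))) (at_right 0)"
    by (intro tendsto_intros) auto
  then show "(?u \<longlongrightarrow> 0) (at_right 0)" by simp
qed simp

section \<open>The capacity formula and its lower bound\<close>

text \<open>Integrability is part of the conclusion because the integral of a non-integrable
  function is 0 by convention; with it, both sides of the formula are genuine integrals.\<close>

theorem mainTheorem4:
  fixes M :: "'a measure" and \<Gamma> :: "'a \<Rightarrow> real"
    and \<gamma>bar q :: real and f :: "real \<Rightarrow> real"
  assumes "prob_space M"
    and "0 < \<gamma>bar" and "0 \<le> q" and "q \<le> 1"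
    and "squared_hoyt M \<Gamma> \<gamma>bar q"
    and "has_pdf_on_nonneg M \<Gamma> f"
  shows "set_integrable lborel {0..} (\<lambda>x. log 2 (1 + x) * f x) \<and>
    set_integrable lborel {0..pi}
      (\<lambda>\<theta>. exp (1 / hoyt_gamma \<gamma>bar q \<theta>) * E1 (1 / hoyt_gamma \<gamma>bar q \<theta>)) \<and>
    capacity f = log 2 (exp 1) / pi *
      (LBINT \<theta>:{0..pi}. exp (1 / hoyt_gamma \<gamma>bar q \<theta>) * E1 (1 / hoyt_gamma \<gamma>bar q \<theta>)) \<and>
    (0 < q \<longrightarrow> capacity f \<ge> hoyt_lower_bound \<gamma>bar q) \<and>
    (q = 0 \<longrightarrow> (\<exists>L. (hoyt_lower_bound \<gamma>bar \<longlongrightarrow> L) (at_right 0) \<and> capacity f \<ge> L))"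
proof -
  from \<open>squared_hoyt M \<Gamma> \<gamma>bar q\<close> obtain \<sigma>x \<sigma>y where \<sigma>: "0 < \<sigma>x" "0 \<le> \<sigma>y" "\<sigma>y \<le> \<sigma>x"
    and q: "q = \<sigma>y / \<sigma>x"
    and mean: "\<gamma>bar = (\<integral>z. z \<partial>gaussian_square_sum_law \<sigma>x \<sigma>y)"
    and law: "distr M borel \<Gamma> = gaussian_square_sum_law \<sigma>x \<sigma>y"
    and [measurable]: "\<Gamma> \<in> borel_measurable M"
    by (auto simp: squared_hoyt_def)
  have \<gamma>bar: "\<gamma>bar = \<sigma>x\<^sup>2 + \<sigma>y\<^sup>2"
    unfolding mean using \<sigma> by (intro gaussian_square_sum_law_mean) auto
  define g where "g = hoyt_gamma \<gamma>bar q"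
  define h where "h = (\<lambda>\<theta>. exp (1 / g \<theta>) * E1 (1 / g \<theta>))"
  \<comment> \<open>Brings \<open>hoyt_gamma\<close> into the form used in
    \<open>nn_integral_log_gaussian_square_sum_law\<close>.\<close>
  have g_eq: "g \<theta> = (\<sigma>x\<^sup>2 + \<sigma>y\<^sup>2) - (\<sigma>x\<^sup>2 - \<sigma>y\<^sup>2) * cos \<theta>" for \<theta>
  proof -
    have "(1 - q\<^sup>2) / (1 + q\<^sup>2) = (\<sigma>x\<^sup>2 - \<sigma>y\<^sup>2) / (\<sigma>x\<^sup>2 + \<sigma>y\<^sup>2)"
    proof -
      have "1 - q\<^sup>2 = (\<sigma>x\<^sup>2 - \<sigma>y\<^sup>2) / \<sigma>x\<^sup>2" "1 + q\<^sup>2 = (\<sigma>x\<^sup>2 + \<sigma>y\<^sup>2) / \<sigma>x\<^sup>2"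
        using \<sigma> unfolding q by (simp_all add: power_divide diff_divide_distrib add_divide_distrib)
      then show ?thesis using \<sigma> by simp
    qed
    moreover have "\<sigma>x\<^sup>2 + \<sigma>y\<^sup>2 \<noteq> 0" using \<open>0 < \<gamma>bar\<close> \<gamma>bar by linarith
    ultimately show ?thesis unfolding g_def hoyt_gamma_def \<gamma>bar by (simp add: right_diff_distrib)
  qed
  have coef: "0 \<le> (1 - q\<^sup>2) / (1 + q\<^sup>2)" "(1 - q\<^sup>2) / (1 + q\<^sup>2) \<le> 1"
    using \<open>0 \<le> q\<close> \<open>q \<le> 1\<close> by (auto simp: power_le_one add_pos_nonneg divide_le_eq_1)
  \<comment> \<open>The value of \<open>g\<close> at angle 0, where the cosine is 1.\<close>
  define \<gamma>min where "\<gamma>min = \<gamma>bar * (1 - (1 - q\<^sup>2) / (1 + q\<^sup>2))"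
  have g_ge: "\<gamma>min \<le> g \<theta>" for \<theta>
    unfolding \<gamma>min_def g_def hoyt_gamma_def using \<open>0 < \<gamma>bar\<close> coef(1)
    by (intro mult_left_mono diff_left_mono mult_left_le) (auto simp del: times_divide_eq_left)
  \<comment> \<open>With \<open>exp_mult_E1_le\<close> this bounds the angular integrand
    \<open>h\<close> by \<open>2 * \<gamma>bar\<close>, hence its integrability.\<close>
  have g_le: "g \<theta> \<le> 2 * \<gamma>bar" for \<theta>
  proof -
    have "\<bar>(1 - q\<^sup>2) / (1 + q\<^sup>2) * cos \<theta>\<bar> \<le> 1 * 1"
      unfolding abs_mult using coef by (intro mult_mono) auto
    then have "- 1 \<le> (1 - q\<^sup>2) / (1 + q\<^sup>2) * cos \<theta>" by linarith
    then have "\<gamma>bar * (1 - (1 - q\<^sup>2) / (1 + q\<^sup>2) * cos \<theta>) \<le> \<gamma>bar * 2"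
      using \<open>0 < \<gamma>bar\<close> by (intro mult_left_mono) (simp_all del: times_divide_eq_left)
    then show ?thesis by (simp add: g_def hoyt_gamma_def)
  qed
  \<comment> \<open>For \<open>q = 0\<close> the value at angle 0 is 0, so positivity holds only
    almost everywhere on \<open>[0, pi]\<close>.\<close>
  have g_pos: "0 < g \<theta>" if "0 < \<theta>" "\<theta> \<le> pi" for \<theta>
  proof -
    have "cos \<theta> < 1" using cos_monotone_0_pi[of 0 \<theta>] that by simp
    then have "(1 - q\<^sup>2) / (1 + q\<^sup>2) * cos \<theta> < 1"
    proof (cases "cos \<theta> \<le> 0")
      case True
      then have "(1 - q\<^sup>2) / (1 + q\<^sup>2) * cos \<theta> \<le> 0" using coef by (intro mult_nonneg_nonpos)
      then show ?thesis by linarith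
    next
      case False
      then have "(1 - q\<^sup>2) / (1 + q\<^sup>2) * cos \<theta> \<le> 1 * cos \<theta>" using coef by (intro mult_right_mono) auto
      then show ?thesis using \<open>cos \<theta> < 1\<close> by linarith
    qed
    then show ?thesis using \<open>0 < \<gamma>bar\<close> by (simp add: g_def hoyt_gamma_def)
  qed
  have [measurable]: "g \<in> borel_measurable borel"
    unfolding g_def hoyt_gamma_def[abs_def] by measurable
  have h_meas [measurable]: "h \<in> borel_measurable borel"
    unfolding h_def by measurable
  have AE_pos: "AE \<theta> in lborel. \<theta> \<in> {0..pi} \<longrightarrow> 0 < g \<theta>"
    using AE_lborel_singleton[of "0::real"] by eventually_elim (auto intro: g_pos)
  have h_bounds: "0 \<le> h \<theta>" "h \<theta> \<le> 2 * \<gamma>bar" if "0 < g \<theta>" for \<theta>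
    using that E1_nonneg[of "1 / g \<theta>"] exp_mult_E1_le[of "1 / g \<theta>"] g_le[of \<theta>] by (auto simp: h_def)
  have h_int: "set_integrable lborel {0..pi} h"
  proof -
    have "integrable lborel (\<lambda>\<theta>. indicator {0..pi} \<theta> *\<^sub>R h \<theta>)"
    proof (rule Bochner_Integration.integrable_bound)
      show "integrable lborel (\<lambda>\<theta>. indicator {0..pi} \<theta> *\<^sub>R (2 * \<gamma>bar))" by simp
      show "AE \<theta> in lborel. norm (indicator {0..pi} \<theta> *\<^sub>R h \<theta>) \<le> norm (indicator {0..pi} \<theta> *\<^sub>R (2 * \<gamma>bar))"
        using AE_pos by eventually_elim (use h_bounds \<open>0 < \<gamma>bar\<close> in \<open>auto split: split_indicator\<close>)
    qed measurable
    then show ?thesis by (simp add: set_integrable_def)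
  qed
  define I where "I = (LBINT \<theta>:{0..pi}. h \<theta>)"
  have AE_nonneg: "AE \<theta> in lborel. 0 \<le> indicator {0..pi} \<theta> *\<^sub>R h \<theta>"
    using AE_pos by eventually_elim (use h_bounds in \<open>auto split: split_indicator\<close>)
  have I_nonneg: "0 \<le> I"
    unfolding I_def set_lebesgue_integral_def by (rule integral_nonneg_AE[OF AE_nonneg])
  have h_nn: "(\<integral>\<^sup>+\<theta>. ennreal (h \<theta>) * indicator {0..pi} \<theta> \<partial>lborel) = ennreal I"
  proof -
    have "(\<integral>\<^sup>+\<theta>. ennreal (h \<theta>) * indicator {0..pi} \<theta> \<partial>lborel)
        = (\<integral>\<^sup>+\<theta>. ennreal (indicator {0..pi} \<theta> *\<^sub>R h \<theta>) \<partial>lborel)"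
      by (intro nn_integral_cong) (auto split: split_indicator)
    then show ?thesis
      using h_int AE_nonneg
      by (simp add: nn_integral_eq_integral set_integrable_def I_def set_lebesgue_integral_def)
  qed
  let ?f = "\<lambda>x. indicator {0..} x * f x"
  have f_nonneg: "0 \<le> f x" if "0 \<le> x" for x
    using \<open>has_pdf_on_nonneg M \<Gamma> f\<close> that by (simp add: has_pdf_on_nonneg_def)
  have pdf: "distributed M lborel \<Gamma> (\<lambda>x. ennreal (?f x))"
    using \<open>has_pdf_on_nonneg M \<Gamma> f\<close> by (simp add: has_pdf_on_nonneg_def)
  \<comment> \<open>\<open>distributed\<close> gives measurability only of the
    \<open>ennreal\<close>-valued density; nonnegativity of \<open>f\<close> on the half-line allows
    passing back to the reals.\<close>
  have f_meas [measurable]: "?f \<in> borel_measurable borel"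
  proof -
    have "(\<lambda>x. ennreal (?f x)) \<in> borel_measurable borel"
      using distributed_borel_measurable[OF pdf] by simp
    then have "(\<lambda>x. enn2real (ennreal (?f x))) \<in> borel_measurable borel" by measurable
    moreover have "(\<lambda>x. enn2real (ennreal (?f x))) = ?f"
      by (intro ext) (auto simp: f_nonneg split: split_indicator)
    ultimately show ?thesis by simp
  qed
  let ?c = "\<lambda>x. indicator {0..} x *\<^sub>R (log 2 (1 + x) * f x)"
  have c_eq: "?c = (\<lambda>x. log 2 (1 + x) * ?f x)" by (auto simp: fun_eq_iff)
  have c_meas [measurable]: "?c \<in> borel_measurable lborel" unfolding c_eq by measurable
  have c_nonneg: "0 \<le> ?c x" for x
    by (auto simp: f_nonneg split: split_indicator)
  \<comment> \<open>The capacity is carried from the density to the expectation over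
    \<open>M\<close>, then to the law of \<open>\<Gamma>\<close>. No closed form of the density is
    involved.\<close>
  have "(\<integral>\<^sup>+x. ennreal (?c x) \<partial>lborel)
      = (\<integral>\<^sup>+x. ennreal (?f x) * ennreal (log 2 (1 + x)) \<partial>lborel)"
    by (intro nn_integral_cong) (auto simp: f_nonneg ennreal_mult mult.commute split: split_indicator)
  also have "\<dots> = (\<integral>\<^sup>+\<omega>. ennreal (log 2 (1 + \<Gamma> \<omega>)) \<partial>M)"
    by (intro distributed_nn_integral[OF pdf]) measurable
  also have "\<dots> = (\<integral>\<^sup>+z. ennreal (log 2 (1 + z)) \<partial>distr M borel \<Gamma>)"
    by (simp add: nn_integral_distr)
  also have "\<dots> = (\<integral>\<^sup>+z. ennreal (1 / ln 2) * ennreal (ln (1 + z)) \<partial>gaussian_square_sum_law \<sigma>x \<sigma>y)"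
    unfolding law by (simp add: log_def ennreal_mult'[symmetric])
  also have "\<dots> = ennreal (1 / ln 2) * (ennreal I / ennreal pi)"
    using nn_integral_log_gaussian_square_sum_law[OF \<sigma>]
    by (simp add: nn_integral_cmult h_nn[unfolded h_def g_eq])
  also have "\<dots> = ennreal (1 / ln 2 * (I / pi))"
    using I_nonneg by (simp add: divide_ennreal ennreal_mult'[symmetric])
  \<comment> \<open>A finite nonnegative integral of a nonnegative function yields integrability and
    the value together.\<close>
  finally have "integrable lborel ?c \<and> integral\<^sup>L lborel ?c = 1 / ln 2 * (I / pi)"
    using c_nonneg I_nonneg
    by (subst (asm) nn_integral_eq_integrable[OF c_meas]) auto
  then have cap_int: "set_integrable lborel {0..} (\<lambda>x. log 2 (1 + x) * f x)"
    and cap: "capacity f = 1 / ln 2 * (I / pi)"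
    by (simp_all add: set_integrable_def capacity_def set_lebesgue_integral_def)
  have lower: "hoyt_lower_bound \<gamma>bar q \<le> capacity f" if "0 < q"
  proof -
    \<comment> \<open>Identifies \<open>1 / \<gamma>min\<close> with the argument of
      \<open>E1\<close> in the lower bound; for \<open>q > 0\<close> the minimum is positive, so
      monotonicity applies at every angle.\<close>
    have "1 - (1 - q\<^sup>2) / (1 + q\<^sup>2) = 2 * q\<^sup>2 / (1 + q\<^sup>2)"
      using add_pos_nonneg[of 1 "q\<^sup>2"] by (simp add: field_simps)
    then have min: "1 / \<gamma>min = (1 + q\<^sup>2) / (2 * q\<^sup>2 * \<gamma>bar)" "\<gamma>min = \<gamma>bar * (2 * q\<^sup>2 / (1 + q\<^sup>2))"
      by (simp_all add: \<gamma>min_def)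
    have min_pos: "0 < \<gamma>min"
      unfolding min(2) using \<open>0 < \<gamma>bar\<close> that by (intro mult_pos_pos divide_pos_pos add_pos_pos) auto
    let ?m = "exp (1 / \<gamma>min) * E1 (1 / \<gamma>min)"
    have "(LBINT \<theta>:{0..pi}. ?m) \<le> I"
      unfolding I_def
    proof (rule set_integral_mono[OF _ h_int])
      show "set_integrable lborel {0..pi} (\<lambda>\<theta>. ?m)" by (simp add: set_integrable_def)
      show "?m \<le> h \<theta>" for \<theta>
        unfolding h_def by (rule exp_mult_E1_inverse_mono[OF min_pos g_ge])
    qed
    then have "pi * ?m \<le> I" by (simp add: set_lebesgue_integral_def mult_ac)
    then have "1 / ln 2 * ?m \<le> 1 / ln 2 * (I / pi)"
      by (intro mult_left_mono) (auto simp: field_simps)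
    then show ?thesis by (simp add: cap hoyt_lower_bound_def min(1) mult.assoc)
  qed
  \<comment> \<open>For \<open>q = 0\<close> the witness for the limit is 0, which turns the bound
    into nonnegativity of the capacity.\<close>
  have "0 \<le> capacity f" using I_nonneg by (simp add: cap)
  then have "(hoyt_lower_bound \<gamma>bar \<longlongrightarrow> 0) (at_right 0) \<and> 0 \<le> capacity f"
    using hoyt_lower_bound_tendsto_0[OF \<open>0 < \<gamma>bar\<close>] by simp
  moreover have "capacity f = log 2 (exp 1) / pi * I"
    by (simp add: cap log_def)
  ultimately show ?thesis
    using cap_int h_int lower unfolding h_def g_def I_def by blast
qed

end
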